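(* Let $(X_k)_{k\in\mathbb{Z}}$ be an $L_2$-stationary sequence of square-integrable real random variables with $E(X_k)=0$, $E(X_k^2)=1$, and such that $X_k$ has the same distribution as $X_0$ for all $k\in\mathbb{Z}$. Let $\rho=\mathrm{corr}(X_0,X_1)$ and $r_2=\mathrm{corr}(X_0,X_2)$, and assume $\rho\ne0$ and $r_2+1-2|\rho|>0$. Suppose there are real constants $a,b,A,B,C$ such that for all $k\in\mathbb{Z}$ $$E(X_k\mid \dots,X_{k-2},X_{k-1},X_{k+1},X_{k+2},\dots)=a(X_{k-1}+X_{k+1})+b,$$ $$E(X_k^2\mid \dots,X_{k-2},X_{k-1},X_{k+1},X_{k+2},\dots)=A(X_{k-1}^2+X_{k+1}^2)+BX_{k-1}X_{k+1}+C,$$ and that $A\left(\rho^2+\frac{1}{\rho^2}\right)+B=1$. Put $R=B\left(\rho+\frac1\rho\right)^2$, assume $R\ge 0$, and let $$q=\frac{\rho^4+R-1}{1+\rho^4(R-1)} .$$ Let the polynomials $Q_n$ be defined by $Q_{-1}(x)=0$, $Q_0(x)=1$ and $$xQ_n(x)=Q_{n+1}(x)+(1+q+\dots+q^{n-1})Q_{n-1}(x),\qquad n\ge 0 .$$ Then for all $n\ge 0$ $$E(Q_n(X_1)\mid X_0)=\rho^nQ_n(X_0).$$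
   Context: $L_2$-stationary means that the variables are square-integrable, $E(X_k)$ does not depend on $k$, and $E(X_kX_{k+j})$ does not depend on $k$ for each $j$. The conditional expectations in the hypotheses are given the $\sigma$-field generated by $\{X_j: j\ne k\}$. Equalities of conditional expectations hold almost surely. For $n=0$ the sum $1+q+\dots+q^{n-1}$ is empty (equal to $0$). *)

theory Defs
  imports "HOL-Probability.Probability" "HOL-Computational_Algebra.Polynomial"
begin

definition covar :: "'a measure \<Rightarrow> ('a \<Rightarrow> real) \<Rightarrow> ('a \<Rightarrow> real) \<Rightarrow> real" where
  "covar M U V =
    (\<integral>\<omega>. (U \<omega> - integral\<^sup>L M U) * (V \<omega> - integral\<^sup>L M V) \<partial>M)"

definition corr :: "'a measure \<Rightarrow> ('a \<Rightarrow> real) \<Rightarrow> ('a \<Rightarrow> real) \<Rightarrow> real" where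
  "corr M U V = covar M U V / (sqrt (covar M U U) * sqrt (covar M V V))"

definition L2_stationary :: "'a measure \<Rightarrow> (int \<Rightarrow> 'a \<Rightarrow> real) \<Rightarrow> bool" where
  "L2_stationary M X \<longleftrightarrow>
    (\<forall>k. X k \<in> borel_measurable M \<and> integrable M (\<lambda>\<omega>. (X k \<omega>)\<^sup>2)) \<and>
    (\<forall>k l. integral\<^sup>L M (X k) = integral\<^sup>L M (X l)) \<and>
    (\<forall>j k l. (\<integral>\<omega>. X k \<omega> * X (k + j) \<omega> \<partial>M) = (\<integral>\<omega>. X l \<omega> * X (l + j) \<omega> \<partial>M))"

(* The sigma-field generated by {X j | j \<in> J}, in the form of a measure on space M
   as expected by real_cond_exp (which only uses its sets). *)
definition sigma_gen_by :: "'a measure \<Rightarrow> (int \<Rightarrow> 'a \<Rightarrow> real) \<Rightarrow> int set \<Rightarrow> 'a measure" where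
  "sigma_gen_by M X J =
    sigma (space M) (\<Union>j\<in>J. {X j -` S \<inter> space M | S. S \<in> sets borel})"

end

theory Submission
  imports Defs
begin

text \<open>The proof has three ingredients.

\<^bold>\<open>Linear regression.\<close> The two-sided regression says that \<open>E(w X k)\<close>, for a weight \<open>w\<close> depending on the past,
satisfies a linear recurrence in \<open>k\<close> with characteristic roots \<open>\<rho>\<close> and \<open>1 / \<rho>\<close>. Bounded second moments exclude
the growing solution, so \<open>E(X (k + 1) | past) = \<rho> X k\<close> (\<open>one_sided_regression_test\<close>). This is the claim
for \<open>n = 1\<close>, with the larger sigma-field of the past in place of that of \<open>X 0\<close>.

\<^bold>\<open>Induction on the degree.\<close> Suppose that \<open>E(Q j (X (k + 1)) | past) = \<rho> ^ j Q j (X k)\<close> for all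
\<open>j \<le> m + 1\<close> and all \<open>k\<close>. The conditional expectations of \<open>X 1 * Q (m + 1) (X 2)\<close> and of
\<open>(X 1)\<^sup>2 * Q m (X 2)\<close> given the past of \<open>0\<close> can both be computed in two ways: through the past of \<open>1\<close>, using the
induction hypothesis, or through all variables other than \<open>X 1\<close>, using the two-sided regressions.
This gives two linear equations for the conditional expectations of \<open>Q (m + 2) (X 1)\<close> and
\<open>Q (m + 2) (X 2)\<close>. Linear regression alone would leave one parameter free; the quadratic one fixes it. The
contributions of \<open>Q (m - 2)\<close> cancel by the condition on \<open>A\<close> and \<open>B\<close>, those of \<open>Q m\<close> by the choice of
\<open>q\<close>, and the remaining system is nonsingular since \<open>B \<ge> 0\<close> (\<open>hermite_regression_step\<close>). Working with the whole past,
and not only with \<open>X 0\<close>, is what makes the first of the two computations possible.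

\<^bold>\<open>Moments.\<close> The step to degree \<open>m + 2\<close> needs moments of order \<open>m + 2\<close>. Second moments suffice for \<open>Q 2\<close>, and its
regression says that the innovation \<open>X 1 - \<rho> X 0\<close> has constant conditional variance; by reversal of time so has
\<open>X 0 - \<rho> X 1\<close>. Since \<open>X 0\<close> is a combination of the two innovations, finiteness of the moment of
order \<open>p\<close> implies that of order \<open>p + 2\<close> (\<open>integrable_even_power\<close>). Thus all moments exist, and the
induction runs through all degrees.\<close>

section \<open>Sigma-fields generated by parts of a process, and conditional expectations\<close>

lemma space_sigma_gen_by [simp]: "space (sigma_gen_by M X J) = space M"
  by (simp add: sigma_gen_by_def space_measure_of_conv)

lemma sets_sigma_gen_by:
  "sets (sigma_gen_by M X J) =
    sigma_sets (space M) (\<Union>j\<in>J. {X j -` S \<inter> space M | S. S \<in> sets borel})"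
  unfolding sigma_gen_by_def by (rule sets_measure_of) auto

lemma measurable_sigma_gen_by [measurable (raw)]:
  assumes "j \<in> J"
  shows "X j \<in> borel_measurable (sigma_gen_by M X J)"
proof (rule measurableI)
  fix S :: "real set" assume "S \<in> sets borel"
  then show "X j -` S \<inter> space (sigma_gen_by M X J) \<in> sets (sigma_gen_by M X J)"
    using assms unfolding sets_sigma_gen_by space_sigma_gen_by
    by (intro sigma_sets.Basic) auto
qed auto

lemma sets_sigma_gen_by_mono:
  "J \<subseteq> K \<Longrightarrow> sets (sigma_gen_by M X J) \<subseteq> sets (sigma_gen_by M X K)"
  unfolding sets_sigma_gen_by by (rule sigma_sets_mono') auto

lemma sigma_gen_by_subalgebra_mono:
  "J \<subseteq> K \<Longrightarrow> subalgebra (sigma_gen_by M X K) (sigma_gen_by M X J)"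
  unfolding subalgebra_def by (simp add: sets_sigma_gen_by_mono)

lemma subalgebra_sigma_gen_by:
  assumes "\<And>j. j \<in> J \<Longrightarrow> X j \<in> borel_measurable M"
  shows "subalgebra M (sigma_gen_by M X J)"
proof -
  have "sets (sigma_gen_by M X J) \<subseteq> sets M"
    unfolding sets_sigma_gen_by
    using assms by (intro sets.sigma_sets_subset) (auto intro: measurable_sets)
  then show ?thesis by (simp add: subalgebra_def)
qed

lemma sigma_gen_by_reindex:
  "sigma_gen_by M (\<lambda>j. X (f j)) J = sigma_gen_by M X (f ` J)"
  by (simp add: sigma_gen_by_def)

lemma borel_measurable_poly [measurable (raw)]:
  fixes p :: "real poly"
  assumes [measurable]: "f \<in> borel_measurable N"
  shows "(\<lambda>x. poly p (f x)) \<in> borel_measurable N"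
  unfolding poly_altdef by measurable

text \<open>A conditional expectation tested against an unbounded weight. Only the product \<open>w * g\<close> has to be
integrable, so that \<open>w\<close> may be a polynomial in the conditioning variables. All computations
below are done with such weighted integrals, which turns identities between random variables into
identities between real numbers.\<close>
lemma (in prob_space) cond_exp_test:
  assumes sub: "subalgebra M F"
    and ce: "AE x in M. real_cond_exp M F g x = h x"
    and w: "w \<in> borel_measurable F"
    and [measurable]: "g \<in> borel_measurable M" "h \<in> borel_measurable M"
    and int: "integrable M (\<lambda>x. w x * g x)"
  shows "integrable M (\<lambda>x. w x * h x)" "(\<integral>x. w x * g x \<partial>M) = (\<integral>x. w x * h x \<partial>M)"
proof -
  interpret finite_measure_subalgebra M F by unfold_locales (rule sub)
  have [measurable]: "w \<in> borel_measurable M" by (rule measurable_from_subalg[OF sub w])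
  have eq: "AE x in M. w x * real_cond_exp M F g x = w x * h x" using ce by auto
  note i = real_cond_exp_intg[OF int w assms(4)]
  show "integrable M (\<lambda>x. w x * h x)"
    by (rule integrable_cong_AE_imp[OF i(1)]) (use eq in auto)
  show "(\<integral>x. w x * g x \<partial>M) = (\<integral>x. w x * h x \<partial>M)"
    using i(2) integral_cong_AE[OF _ _ eq] by simp
qed

lemma (in prob_space) cond_exp_from_indicators:
  assumes sub: "subalgebra M F"
    and "\<And>S. S \<in> sets F \<Longrightarrow> (\<integral>x. indicator S x * g x \<partial>M) = (\<integral>x. indicator S x * h x \<partial>M)"
    and "integrable M g" "integrable M h" "h \<in> borel_measurable F"
  shows "AE x in M. real_cond_exp M F g x = h x"
proof -
  interpret finite_measure_subalgebra M F by unfold_locales (rule sub)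
  show ?thesis
    by (rule real_cond_exp_charact) (use assms in \<open>auto simp: set_lebesgue_integral_def\<close>)
qed

section \<open>The linear recurrence behind linear regression\<close>

text \<open>The solutions of the recurrence are spanned by \<open>\<rho> ^ k\<close> and \<open>\<rho> ^ (- k)\<close>. The combination
\<open>y (k + 1) - \<rho> y k\<close> isolates the growing solution: it is multiplied by \<open>1 / \<rho>\<close> at each
step, so boundedness forces it to vanish.\<close>
lemma bounded_three_term_recurrence:
  fixes y :: "nat \<Rightarrow> real"
  assumes rho: "\<rho> \<noteq> 0" "\<bar>\<rho>\<bar> < 1" and a: "a * (1 + \<rho>\<^sup>2) = \<rho>"
    and rec: "\<And>k. y (Suc k) = a * (y k + y (Suc (Suc k)))"
    and bd: "\<And>k. \<bar>y k\<bar> \<le> K"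
  shows "y (Suc 0) = \<rho> * y 0"
proof -
  define d where "d k = y (Suc k) - \<rho> * y k" for k
  have step: "d k = \<rho> * d (Suc k)" for k
  proof -
    have "(1 + \<rho>\<^sup>2) * y (Suc k) = a * (1 + \<rho>\<^sup>2) * (y k + y (Suc (Suc k)))"
      using rec[of k] by (simp add: algebra_simps)
    then have "(1 + \<rho>\<^sup>2) * y (Suc k) = \<rho> * (y k + y (Suc (Suc k)))" using a by simp
    then show ?thesis unfolding d_def by (simp add: algebra_simps power2_eq_square)
  qed
  have d0: "d 0 = \<rho> ^ k * d k" for k
  proof (induction k)
    case (Suc k)
    then show ?case using step[of k] by simp
  qed simp
  have "(\<lambda>k. \<rho> ^ k * d k) \<longlonglongrightarrow> 0"
  proof (rule Lim_null_comparison)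
    have db: "\<bar>d k\<bar> \<le> 2 * K" for k
    proof -
      have "\<bar>d k\<bar> \<le> \<bar>y (Suc k)\<bar> + \<bar>\<rho>\<bar> * \<bar>y k\<bar>"
        unfolding d_def using abs_triangle_ineq4[of "y (Suc k)" "\<rho> * y k"] by (simp add: abs_mult)
      also have "\<dots> \<le> K + 1 * K"
        using bd[of k] bd[of "Suc k"] rho by (intro add_mono mult_mono) auto
      finally show ?thesis by simp
    qed
    show "\<forall>\<^sub>F k in sequentially. norm (\<rho> ^ k * d k) \<le> \<bar>\<rho>\<bar> ^ k * (2 * K)"
      using db by (intro always_eventually allI) (auto simp: abs_mult power_abs intro!: mult_left_mono)
    show "(\<lambda>k. \<bar>\<rho>\<bar> ^ k * (2 * K)) \<longlonglongrightarrow> 0"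
      using rho by (intro tendsto_mult_left_zero LIMSEQ_power_zero) auto
  qed
  then have "(\<lambda>k::nat. d 0) \<longlonglongrightarrow> 0" using d0 by simp
  then have "d 0 = 0" by (simp add: LIMSEQ_const_iff)
  then show ?thesis by (simp add: d_def)
qed

lemma contracting_root_exists:
  fixes a :: real
  assumes "a \<noteq> 0" "\<bar>a\<bar> < 1 / 2"
  obtains \<rho> where "\<rho> \<noteq> 0" "\<bar>\<rho>\<bar> < 1" "a * (1 + \<rho>\<^sup>2) = \<rho>"
proof -
  define s where "s = sqrt (1 - 4 * a\<^sup>2)"
  have a2: "4 * a\<^sup>2 < 1"
    using assms abs_square_less_1[of "2 * a"] by (simp add: power_mult_distrib)
  have s: "s\<^sup>2 = 1 - 4 * a\<^sup>2" "s > 0" using a2 by (auto simp: s_def)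
  have s1: "1 + s > 1" using s by simp
  \<comment> \<open>the smaller root of \<open>a x\<^sup>2 - x + a\<close>, rationalised\<close>
  define r where "r = 2 * a / (1 + s)"
  have "\<bar>r\<bar> < 1" using assms s1 by (simp add: r_def abs_mult)
  moreover have "r \<noteq> 0" using assms s1 by (simp add: r_def)
  moreover have "a * (1 + r\<^sup>2) = r"
  proof -
    have "(1 + s)\<^sup>2 + 4 * a\<^sup>2 = 2 * (1 + s)"
      using s(1) by (simp add: power2_eq_square algebra_simps)
    moreover have "1 + r\<^sup>2 = ((1 + s)\<^sup>2 + 4 * a\<^sup>2) / (1 + s)\<^sup>2"
      using s1 by (simp add: r_def power_divide power_mult_distrib add_divide_distrib)
    ultimately have "1 + r\<^sup>2 = 2 * (1 + s) / ((1 + s) * (1 + s))"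
      by (simp only: power2_eq_square[of "1 + s"])
    then have "1 + r\<^sup>2 = 2 / (1 + s)"
      using s1 by (simp only: nonzero_mult_divide_mult_cancel_right)
    then show ?thesis by (simp add: r_def)
  qed
  ultimately show ?thesis using that by blast
qed

section \<open>Integrability of polynomials in two variables\<close>

lemma abs_poly_le_max_power:
  fixes p :: "real poly"
  obtains K where "K \<ge> 0" "\<And>x. \<bar>poly p x\<bar> \<le> K * (max 1 \<bar>x\<bar>) ^ degree p"
proof
  let ?K = "\<Sum>i\<le>degree p. \<bar>coeff p i\<bar>"
  show "?K \<ge> 0" by (intro sum_nonneg) auto
  fix x :: real
  have "\<bar>poly p x\<bar> \<le> (\<Sum>i\<le>degree p. \<bar>coeff p i * x ^ i\<bar>)"
    unfolding poly_altdef by (rule sum_abs)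
  also have "\<dots> \<le> (\<Sum>i\<le>degree p. \<bar>coeff p i\<bar> * (max 1 \<bar>x\<bar>) ^ degree p)"
  proof (intro sum_mono)
    fix i assume "i \<in> {..degree p}"
    then have "\<bar>x\<bar> ^ i \<le> (max 1 \<bar>x\<bar>) ^ degree p"
      by (intro order_trans[OF power_mono[of "\<bar>x\<bar>" "max 1 \<bar>x\<bar>"] power_increasing]) auto
    then show "\<bar>coeff p i * x ^ i\<bar> \<le> \<bar>coeff p i\<bar> * (max 1 \<bar>x\<bar>) ^ degree p"
      by (simp add: abs_mult power_abs mult_left_mono)
  qed
  finally show "\<bar>poly p x\<bar> \<le> ?K * (max 1 \<bar>x\<bar>) ^ degree p" by (simp add: sum_distrib_right)
qed

lemma max_one_power_le:
  fixes x y :: real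
  assumes "i + j \<le> N"
  shows "(max 1 \<bar>x\<bar>) ^ i * (max 1 \<bar>y\<bar>) ^ j \<le> 1 + \<bar>x\<bar> ^ N + \<bar>y\<bar> ^ N"
proof -
  define m where "m = max 1 (max \<bar>x\<bar> \<bar>y\<bar>)"
  have "(max 1 \<bar>x\<bar>) ^ i * (max 1 \<bar>y\<bar>) ^ j \<le> m ^ i * m ^ j"
    by (intro mult_mono power_mono) (auto simp: m_def)
  also have "\<dots> \<le> m ^ N"
    unfolding power_add[symmetric] using assms by (intro power_increasing) (auto simp: m_def)
  also have "\<dots> \<le> 1 + \<bar>x\<bar> ^ N + \<bar>y\<bar> ^ N"
    by (auto simp: m_def max_def)
  finally show ?thesis .
qed

lemma integrable_mult_of_squares:
  fixes U V :: "'a \<Rightarrow> real"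
  assumes [measurable]: "U \<in> borel_measurable M" "V \<in> borel_measurable M"
    and sq: "integrable M (\<lambda>\<omega>. (U \<omega>)\<^sup>2)" "integrable M (\<lambda>\<omega>. (V \<omega>)\<^sup>2)"
  shows "integrable M (\<lambda>\<omega>. U \<omega> * V \<omega>)"
    and "\<bar>\<integral>\<omega>. U \<omega> * V \<omega> \<partial>M\<bar> \<le> (\<integral>\<omega>. (U \<omega>)\<^sup>2 \<partial>M) + (\<integral>\<omega>. (V \<omega>)\<^sup>2 \<partial>M)"
proof -
  have uv: "\<bar>u * v\<bar> \<le> u\<^sup>2 + v\<^sup>2" for u v :: real
    using sum_squares_bound[of "\<bar>u\<bar>" "\<bar>v\<bar>"] by (auto simp: abs_mult intro: order_trans[rotated])
  have i: "integrable M (\<lambda>\<omega>. (U \<omega>)\<^sup>2 + (V \<omega>)\<^sup>2)" using sq by auto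
  show int: "integrable M (\<lambda>\<omega>. U \<omega> * V \<omega>)"
    by (rule Bochner_Integration.integrable_bound[OF i]) (use uv in auto)
  have "\<bar>\<integral>\<omega>. U \<omega> * V \<omega> \<partial>M\<bar> \<le> (\<integral>\<omega>. \<bar>U \<omega> * V \<omega>\<bar> \<partial>M)" by (rule integral_abs_bound)
  also have "\<dots> \<le> (\<integral>\<omega>. (U \<omega>)\<^sup>2 + (V \<omega>)\<^sup>2 \<partial>M)"
    using int i uv by (intro integral_mono) auto
  finally show "\<bar>\<integral>\<omega>. U \<omega> * V \<omega> \<partial>M\<bar> \<le> (\<integral>\<omega>. (U \<omega>)\<^sup>2 \<partial>M) + (\<integral>\<omega>. (V \<omega>)\<^sup>2 \<partial>M)"
    using sq by simp
qed

lemma (in prob_space) integrable_poly_mult_poly: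
  fixes p r :: "real poly"
  assumes [measurable]: "U \<in> borel_measurable M" "V \<in> borel_measurable M"
    and int: "integrable M (\<lambda>x. \<bar>U x\<bar> ^ N)" "integrable M (\<lambda>x. \<bar>V x\<bar> ^ N)"
    and deg: "degree p + degree r \<le> N"
  shows "integrable M (\<lambda>x. poly p (U x) * poly r (V x))"
proof -
  obtain K where K: "K \<ge> 0" "\<And>x. \<bar>poly p x\<bar> \<le> K * (max 1 \<bar>x\<bar>) ^ degree p"
    using abs_poly_le_max_power by blast
  obtain L where L: "L \<ge> 0" "\<And>x. \<bar>poly r x\<bar> \<le> L * (max 1 \<bar>x\<bar>) ^ degree r"
    using abs_poly_le_max_power by blast
  show ?thesis
  proof (rule Bochner_Integration.integrable_bound)
    show "integrable M (\<lambda>x. K * L * (1 + \<bar>U x\<bar> ^ N + \<bar>V x\<bar> ^ N))" using int by auto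
    have "\<bar>poly p u * poly r v\<bar> \<le> K * L * (1 + \<bar>u\<bar> ^ N + \<bar>v\<bar> ^ N)" for u v
    proof -
      have "\<bar>poly p u * poly r v\<bar> \<le> (K * (max 1 \<bar>u\<bar>) ^ degree p) * (L * (max 1 \<bar>v\<bar>) ^ degree r)"
        unfolding abs_mult using K L by (intro mult_mono) auto
      also have "\<dots> = K * L * ((max 1 \<bar>u\<bar>) ^ degree p * (max 1 \<bar>v\<bar>) ^ degree r)"
        by simp
      also have "\<dots> \<le> K * L * (1 + \<bar>u\<bar> ^ N + \<bar>v\<bar> ^ N)"
        using K L max_one_power_le[OF deg] by (intro mult_left_mono) auto
      finally show ?thesis .
    qed
    then show "AE x in M. norm (poly p (U x) * poly r (V x)) \<le> norm (K * L * (1 + \<bar>U x\<bar> ^ N + \<bar>V x\<bar> ^ N))"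
      by (intro AE_I2) (metis abs_ge_self order_trans real_norm_def)
  qed measurable
qed

section \<open>One-sided linear regression\<close>

text \<open>The number \<open>\<rho>\<close> enters as the root of modulus less than one of \<open>a (1 + x\<^sup>2) = x\<close>. That it is the
correlation of neighbours is a consequence of the one-sided regression below.\<close>
locale linear_regression_field = prob_space M for M :: "'a measure" +
  fixes X :: "int \<Rightarrow> 'a \<Rightarrow> real" and a \<rho> :: real
  assumes rv [measurable]: "X k \<in> borel_measurable M"
    and square_integrable: "integrable M (\<lambda>\<omega>. (X k \<omega>)\<^sup>2)"
    and second_moment: "(\<integral>\<omega>. (X k \<omega>)\<^sup>2 \<partial>M) = 1"
    and rho: "\<rho> \<noteq> 0" "\<bar>\<rho>\<bar> < 1"
    and a: "a * (1 + \<rho>\<^sup>2) = \<rho>"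
    and linear_regression: "AE \<omega> in M. real_cond_exp M (sigma_gen_by M X {j. j \<noteq> k}) (X k) \<omega>
            = a * (X (k - 1) \<omega> + X (k + 1) \<omega>)"
begin

abbreviation past :: "int \<Rightarrow> 'a measure" where
  "past k \<equiv> sigma_gen_by M X {..k}"

abbreviation others :: "int \<Rightarrow> 'a measure" where
  "others k \<equiv> sigma_gen_by M X {j. j \<noteq> k}"

lemma subalgebra_gen: "subalgebra M (sigma_gen_by M X J)"
  by (rule subalgebra_sigma_gen_by) (rule rv)

lemma measurable_gen_imp_measurable:
  "w \<in> borel_measurable (sigma_gen_by M X J) \<Longrightarrow> w \<in> borel_measurable M"
  by (rule measurable_from_subalg[OF subalgebra_gen])

lemma measurable_gen_mono:
  "w \<in> borel_measurable (sigma_gen_by M X J) \<Longrightarrow> J \<subseteq> K \<Longrightarrow> w \<in> borel_measurable (sigma_gen_by M X K)"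
  by (rule measurable_from_subalg[OF sigma_gen_by_subalgebra_mono])

text \<open>Two-sided regression on the neighbours implies the one-sided regression
\<open>E(X (k + 1) | past k) = \<rho> X k\<close>: as \<open>w\<close> depends only on indices up to \<open>k\<close>, the sequence
\<open>E(w X (k + i))\<close> satisfies the recurrence of \<open>bounded_three_term_recurrence\<close> for \<open>i > 0\<close>, and
square integrability keeps it bounded.\<close>
lemma one_sided_regression_test:
  assumes w: "w \<in> borel_measurable (past k)" and sq: "integrable M (\<lambda>\<omega>. (w \<omega>)\<^sup>2)"
  shows "(\<integral>\<omega>. w \<omega> * X (k + 1) \<omega> \<partial>M) = \<rho> * (\<integral>\<omega>. w \<omega> * X k \<omega> \<partial>M)"
proof -
  have wM [measurable]: "w \<in> borel_measurable M" by (rule measurable_gen_imp_measurable[OF w])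
  have int: "integrable M (\<lambda>\<omega>. w \<omega> * X i \<omega>)" for i
    by (intro integrable_mult_of_squares sq square_integrable) auto
  define y where "y i = (\<integral>\<omega>. w \<omega> * X (k + int i) \<omega> \<partial>M)" for i
  have "y (Suc i) = a * (y i + y (Suc (Suc i)))" for i
  proof -
    let ?l = "k + int (Suc i)"
    have w': "w \<in> borel_measurable (others ?l)" by (rule measurable_gen_mono[OF w]) auto
    have "y (Suc i) = (\<integral>\<omega>. w \<omega> * (a * (X (?l - 1) \<omega> + X (?l + 1) \<omega>)) \<partial>M)"
      unfolding y_def
      by (rule cond_exp_test[OF subalgebra_gen linear_regression w' _ _ int]) measurable
    also have "\<dots> = (\<integral>\<omega>. a * (w \<omega> * X (?l - 1) \<omega> + w \<omega> * X (?l + 1) \<omega>) \<partial>M)"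
      by (simp add: algebra_simps)
    also have "\<dots> = a * ((\<integral>\<omega>. w \<omega> * X (?l - 1) \<omega> \<partial>M) + (\<integral>\<omega>. w \<omega> * X (?l + 1) \<omega> \<partial>M))"
      using int by simp
    also have "?l - 1 = k + int i" by simp
    also have "?l + 1 = k + int (Suc (Suc i))" by simp
    finally show ?thesis by (simp only: y_def)
  qed
  moreover have "\<bar>y i\<bar> \<le> (\<integral>\<omega>. (w \<omega>)\<^sup>2 \<partial>M) + 1" for i
    using integrable_mult_of_squares(2)[OF wM rv sq square_integrable, of "k + int i"]
    by (simp add: y_def second_moment)
  ultimately have "y (Suc 0) = \<rho> * y 0"
    by (intro bounded_three_term_recurrence[OF rho a])
  then show ?thesis by (simp add: y_def)
qed

text \<open>The hypotheses are invariant under reversal of time. This is how regressions of \<open>X k\<close> on the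
future are obtained.\<close>
lemma reflected_field: "linear_regression_field M (\<lambda>j. X (- j)) a \<rho>"
proof unfold_locales
  show "AE \<omega> in M. real_cond_exp M (sigma_gen_by M (\<lambda>j. X (- j)) {j. j \<noteq> k}) (X (- k)) \<omega>
            = a * (X (- (k - 1)) \<omega> + X (- (k + 1)) \<omega>)" for k
  proof -
    have "uminus ` {j. j \<noteq> k} = {j. j \<noteq> - k}"
      by (auto simp: image_iff) (metis minus_minus)
    then show ?thesis
      using linear_regression[of "- k"] sigma_gen_by_reindex[of M X uminus]
      by (simp add: add.commute minus_diff_commute)
  qed
qed (use square_integrable second_moment rho a in auto)

end

section \<open>The q-Hermite polynomials\<close>

abbreviation (input) q_number :: "real \<Rightarrow> nat \<Rightarrow> real" where
  "q_number q n \<equiv> \<Sum>i<n. q ^ i"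

text \<open>These are the continuous q-Hermite polynomials, normalised to be monic: for \<open>q = 1\<close> they are the Hermite polynomials of the standard normal law, and for
\<open>q = 0\<close> the Chebyshev polynomials of the semicircle law.\<close>
fun q_hermite :: "real \<Rightarrow> nat \<Rightarrow> real poly" where
  "q_hermite q 0 = 1"
| "q_hermite q (Suc 0) = [:0, 1:]"
| "q_hermite q (Suc (Suc n)) =
     [:0, 1:] * q_hermite q (Suc n) - smult (q_number q (Suc n)) (q_hermite q n)"

lemma q_number_Suc: "q_number q (Suc n) = 1 + q * q_number q n"
  by (simp add: sum.lessThan_Suc_shift sum_distrib_left del: sum.lessThan_Suc)

text \<open>For \<open>n = 0\<close> the truncated index \<open>n - 1\<close> is harmless because \<open>[0] = 0\<close>. The same remark
covers \<open>n - 2\<close> in the expansion of \<open>x\<^sup>2\<close> times a q-Hermite polynomial, where the coefficient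
\<open>[n] [n - 1]\<close> vanishes for \<open>n < 2\<close>.\<close>
lemma x_times_q_hermite:
  "x * poly (q_hermite q n) x =
     poly (q_hermite q (Suc n)) x + q_number q n * poly (q_hermite q (n - 1)) x"
  by (cases n) auto

lemma degree_q_hermite: "degree (q_hermite q n) \<le> n"
proof (induction q n rule: q_hermite.induct)
  case (3 q n)
  have "degree ([:0, 1:] * q_hermite q (Suc n)) \<le> Suc (Suc n)"
    using degree_mult_le[of "[:0, 1:]" "q_hermite q (Suc n)"] 3 by simp
  moreover have "degree (smult (q_number q (Suc n)) (q_hermite q n)) \<le> Suc (Suc n)"
    using degree_smult_le[of "q_number q (Suc n)" "q_hermite q n"] 3 by linarith
  ultimately show ?case unfolding q_hermite.simps by (rule degree_diff_le)
qed auto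

lemma x_squared_times_q_hermite:
  "x\<^sup>2 * poly (q_hermite q n) x = poly (q_hermite q (n + 2)) x
     + (q_number q (n + 1) + q_number q n) * poly (q_hermite q n) x
     + q_number q n * (q_number q (n - 1) * poly (q_hermite q (n - 2)) x)"
proof (cases n)
  case 0
  then show ?thesis by (simp add: power2_eq_square)
next
  case (Suc m)
  have "x\<^sup>2 * poly (q_hermite q n) x = x * (x * poly (q_hermite q n) x)"
    by (simp add: power2_eq_square)
  also have "\<dots> = x * poly (q_hermite q (Suc n)) x + q_number q n * (x * poly (q_hermite q m) x)"
    by (subst x_times_q_hermite) (simp add: Suc algebra_simps del: sum.lessThan_Suc q_hermite.simps)
  also have "\<dots> = poly (q_hermite q (Suc (Suc n))) x + q_number q (Suc n) * poly (q_hermite q n) x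
      + q_number q n * (poly (q_hermite q n) x + q_number q m * poly (q_hermite q (m - 1)) x)"
    unfolding x_times_q_hermite Suc by simp
  finally show ?thesis
    by (simp add: Suc algebra_simps del: sum.lessThan_Suc q_hermite.simps)
qed

section \<open>The algebra of the induction step\<close>

text \<open>The factor \<open>1 - A (1 + \<rho>\<^sup>2)\<close> has to be divided out at the end of every induction step. If \<open>A (1 + \<rho>\<^sup>2) = 1\<close>, the compatibility
condition gives \<open>B = - (1 - \<rho>\<^sup>2) / (\<rho>\<^sup>2 (1 + \<rho>\<^sup>2)) < 0\<close>.\<close>
lemma leading_coefficient_nonzero:
  fixes \<rho> A B :: real
  assumes rho: "\<rho> \<noteq> 0" "\<bar>\<rho>\<bar> < 1" and compat: "A * (\<rho>\<^sup>2 + 1 / \<rho>\<^sup>2) + B = 1" and "B \<ge> 0"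
  shows "1 - A * (1 + \<rho>\<^sup>2) \<noteq> 0"
proof
  assume A: "1 - A * (1 + \<rho>\<^sup>2) = 0"
  have r2: "0 < \<rho>\<^sup>2" "\<rho>\<^sup>2 < 1" using rho by (auto simp: abs_square_less_1)
  have "\<rho>\<^sup>2 = (A * (\<rho>\<^sup>2 + 1 / \<rho>\<^sup>2) + B) * \<rho>\<^sup>2" using compat by simp
  also have "\<dots> = A * (\<rho>\<^sup>2 * \<rho>\<^sup>2 + 1) + B * \<rho>\<^sup>2" using rho by (simp add: field_simps)
  finally have e: "A * (\<rho>\<^sup>2 * \<rho>\<^sup>2 + 1) + B * \<rho>\<^sup>2 = \<rho>\<^sup>2" by simp
  have "\<rho>\<^sup>2 * \<rho>\<^sup>2 + 1 + B * \<rho>\<^sup>2 * (1 + \<rho>\<^sup>2) = \<rho>\<^sup>2 * (1 + \<rho>\<^sup>2)"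
    using A e by algebra
  moreover have "B * \<rho>\<^sup>2 * (1 + \<rho>\<^sup>2) \<ge> 0" using \<open>B \<ge> 0\<close> by simp
  ultimately show False using r2 by (simp add: algebra_simps)
qed

text \<open>The linear system solved in the induction step from degrees up to \<open>m + 1\<close> to degree \<open>m + 2\<close>.
Here \<open>s = \<rho> ^ m\<close>, \<open>g = [m]\<close>, \<open>g1 = [m + 1]\<close>, and \<open>u0, u1, u2\<close> are the weighted integrals of
the polynomial of degree \<open>m + 2\<close> at times \<open>k, k + 1, k + 2\<close>; \<open>c\<close> and \<open>v0, v1, v2\<close> are those of
degrees \<open>m\<close> and \<open>m - 2\<close>, the latter with the factor \<open>[m] [m - 1]\<close>; \<open>t\<close> is \<open>[m]\<close> times that of the variable at time \<open>k\<close>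
times the polynomial of degree \<open>m - 1\<close> at time \<open>k + 2\<close>. Equation \<open>e1\<close> says
\<open>u2 = (1 + \<rho>\<^sup>2) s u1 - \<rho>\<^sup>2 s\<^sup>2 u0\<close>, which leaves a one-parameter family of solutions; \<open>e2\<close> is the
independent second relation. In \<open>e2\<close> the terms in \<open>v0\<close> cancel by the compatibility condition
\<open>A (\<rho>\<^sup>2 + 1 / \<rho>\<^sup>2) + B = 1\<close>, and the terms in \<open>c\<close> cancel precisely because
\<open>[m + 1] = 1 + q [m]\<close> with the given \<open>q\<close>.\<close>
lemma q_hermite_step_algebra:
  fixes \<rho> a A B C q s c g g1 u0 u1 u2 v0 v1 v2 t :: real
  assumes rho: "\<rho> \<noteq> 0" "s \<noteq> 0" and a: "a * (1 + \<rho>\<^sup>2) = \<rho>"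
    and compat: "A * (\<rho>\<^sup>2 + 1 / \<rho>\<^sup>2) + B = 1" and nz: "1 - A * (1 + \<rho>\<^sup>2) \<noteq> 0"
    and C: "C = 1 - 2 * A - B * \<rho>\<^sup>2"
    and q: "q * (1 - 2 * A - B * \<rho>\<^sup>2) = 2 * A + B / \<rho>\<^sup>2 - 1"
    and g1: "g1 = 1 + q * g"
    and e1: "s * \<rho> * (u1 + g1 * (s * c))
      = a * (\<rho>\<^sup>2 * s\<^sup>2 * (u0 + g1 * c) + (u2 + g1 * (s\<^sup>2 * c)))"
    and e2: "s * (u1 + (g1 + g) * (s * c) + v1)
      = A * (s\<^sup>2 * (u0 + (g1 + g) * c + v0)) + A * (u2 + (g1 + g) * (s\<^sup>2 * c) + v2)
        + B * (\<rho>\<^sup>2 * s\<^sup>2 * (u0 + g1 * c) + t) + C * (s\<^sup>2 * c)"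
    and v1: "\<rho>\<^sup>2 * v1 = s * v0" and v2: "\<rho>\<^sup>2 * \<rho>\<^sup>2 * v2 = s\<^sup>2 * v0"
    and t: "\<rho>\<^sup>2 * t = s\<^sup>2 * (g * c + v0)"
  shows "u1 = \<rho>\<^sup>2 * s * u0"
proof -
  define x where "x = \<rho>\<^sup>2"
  have x: "x \<noteq> 0" using rho by (simp add: x_def)
  have "\<rho> * (s * (1 + x) * (u1 + g1 * (s * c)))
      = a * (1 + x) * (x * s\<^sup>2 * (u0 + g1 * c) + (u2 + g1 * (s\<^sup>2 * c)))"
    using e1 unfolding x_def by algebra
  then have "\<rho> * (s * (1 + x) * (u1 + g1 * (s * c)))
      = \<rho> * (x * s\<^sup>2 * (u0 + g1 * c) + (u2 + g1 * (s\<^sup>2 * c)))"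
    using a by (simp add: x_def)
  then have "s * (1 + x) * (u1 + g1 * (s * c)) = x * s\<^sup>2 * (u0 + g1 * c) + (u2 + g1 * (s\<^sup>2 * c))"
    using rho by simp
  then have u2: "u2 = s * (1 + x) * u1 - x * s\<^sup>2 * u0" by algebra
  have compat': "A * (x * x + 1) + B * x = x"
    using compat x unfolding x_def[symmetric] by (simp add: field_simps)
  have q': "q * (x * (1 - 2 * A - B * x)) = 2 * A * x + B - x"
    using q x unfolding x_def[symmetric] by (simp add: field_simps)
  have "x * x * s * (1 - A * (1 + x)) * (u1 - x * s * u0) = 0"
    using e2 u2 compat' q' g1 C v1 v2 t unfolding x_def[symmetric] by algebra
  then show ?thesis using x rho nz by (simp add: x_def)
qed

text \<open>The closed formula for \<open>q\<close> in terms of \<open>\<rho>\<close> and \<open>R\<close> is the quotient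
\<open>(2 A + B / \<rho>\<^sup>2 - 1) / (1 - 2 A - B \<rho>\<^sup>2)\<close>, the form in which \<open>q\<close> occurs in the induction step.
With \<open>x = \<rho>\<^sup>2\<close>, expressing \<open>A\<close> and \<open>B\<close> through \<open>R\<close> makes the factor
\<open>(1 - x) / ((1 + x\<^sup>2) (1 + x))\<close> appear in both numerator and denominator; the denominator of \<open>q\<close>
is positive because \<open>R \<ge> 0\<close>.\<close>
lemma q_from_parameters:
  fixes \<rho> A B R q :: real
  assumes rho: "\<rho> \<noteq> 0" "\<bar>\<rho>\<bar> < 1" and compat: "A * (\<rho>\<^sup>2 + 1 / \<rho>\<^sup>2) + B = 1"
    and R: "R = B * (\<rho> + 1 / \<rho>)\<^sup>2" "R \<ge> 0"
    and q: "q = (\<rho> ^ 4 + R - 1) / (1 + \<rho> ^ 4 * (R - 1))"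
  shows "q * (1 - 2 * A - B * \<rho>\<^sup>2) = 2 * A + B / \<rho>\<^sup>2 - 1"
proof -
  define x where "x = \<rho>\<^sup>2"
  have x: "0 < x" "x < 1" using rho by (auto simp: x_def abs_square_less_1)
  have r4: "\<rho> ^ 4 = x * x" by (simp add: x_def power4_eq_xxxx power2_eq_square)
  have "x * x < 1" using mult_strict_mono[of x 1 x 1] x by simp
  moreover have "x * x * R \<ge> 0" using R(2) x by simp
  ultimately have "1 + x * x * (R - 1) > 0" by (simp add: algebra_simps)
  then have q': "q * (1 + x * x * (R - 1)) = x * x + R - 1" unfolding q r4 by simp
  have "R * x = B * (1 + x) * (1 + x)"
    unfolding R(1) x_def using rho by (simp add: field_simps power2_eq_square)
  moreover have "A * (x * x + 1) + B * x = x"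
    using compat x unfolding x_def[symmetric] by (simp add: field_simps)
  ultimately have "(1 + x * x) * (1 + x) * (q * (x * (1 - 2 * A - B * x)) - (2 * A * x + B - x)) = 0"
    using q' by algebra
  moreover have "(1 + x * x) * (1 + x) > 0" using x by (intro mult_pos_pos add_pos_pos) auto
  ultimately have "q * (x * (1 - 2 * A - B * x)) - (2 * A * x + B - x) = 0"
    by (metis less_irrefl mult_eq_0_iff)
  then have "x * (q * (1 - 2 * A - B * x)) = 2 * A * x + B - x" by (simp add: mult.left_commute)
  then have "q * (1 - 2 * A - B * x) = (2 * A * x + B - x) / x" using x by (simp add: field_simps)
  also have "\<dots> = 2 * A + B / x - 1" using x by (simp add: field_simps)
  finally show ?thesis by (simp add: x_def)
qed

section \<open>Regression of q-Hermite polynomials on the past\<close>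

locale quadratic_regression_field = linear_regression_field +
  fixes A B C q :: real
  assumes quadratic_regression:
      "AE \<omega> in M. real_cond_exp M (sigma_gen_by M X {j. j \<noteq> k}) (\<lambda>\<omega>. (X k \<omega>)\<^sup>2) \<omega>
         = A * ((X (k - 1) \<omega>)\<^sup>2 + (X (k + 1) \<omega>)\<^sup>2) + B * X (k - 1) \<omega> * X (k + 1) \<omega> + C"
    and compat: "A * (\<rho>\<^sup>2 + 1 / \<rho>\<^sup>2) + B = 1"
    and B_nonneg: "B \<ge> 0"
    and C: "C = 1 - 2 * A - B * \<rho>\<^sup>2"
    and q: "q * (1 - 2 * A - B * \<rho>\<^sup>2) = 2 * A + B / \<rho>\<^sup>2 - 1"
begin

abbreviation H :: "nat \<Rightarrow> real \<Rightarrow> real" where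
  "H n x \<equiv> poly (q_hermite q n) x"

abbreviation hermite_regression :: "nat \<Rightarrow> int \<Rightarrow> bool" where
  "hermite_regression n k \<equiv>
     AE \<omega> in M. real_cond_exp M (past k) (\<lambda>\<omega>. H n (X (k + 1) \<omega>)) \<omega> = \<rho> ^ n * H n (X k \<omega>)"

lemma integrable_power_times_hermite:
  assumes mom: "\<And>k. integrable M (\<lambda>\<omega>. \<bar>X k \<omega>\<bar> ^ N)" and "d + j \<le> N"
  shows "integrable M (\<lambda>\<omega>. X i \<omega> ^ d * H j (X l \<omega>))"
proof -
  have "degree (monom (1::real) d) + degree (q_hermite q j) \<le> N"
    using degree_q_hermite[of q j] assms(2) by (simp add: degree_monom_eq)
  from integrable_poly_mult_poly[OF rv rv mom mom this, of i l]
  show ?thesis by (simp add: poly_monom)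
qed

lemma hermite_regression_zero: "hermite_regression 0 k"
  by (rule cond_exp_from_indicators[OF subalgebra_gen]) auto

lemma hermite_regression_one: "hermite_regression 1 k"
proof (rule cond_exp_from_indicators[OF subalgebra_gen])
  fix S assume S: "S \<in> sets (past k)"
  have "indicator S \<in> borel_measurable (past k)"
    using S by simp
  moreover have "integrable M (\<lambda>\<omega>. (indicator S \<omega> :: real)\<^sup>2)"
    using S subalgebra_gen[of "{..k}"]
    by (intro integrable_const_bound[of _ 1])
       (auto simp: subalgebra_def indicator_def power2_eq_square split: if_splits)
  ultimately show "(\<integral>\<omega>. indicator S \<omega> * H 1 (X (k + 1) \<omega>) \<partial>M)
      = (\<integral>\<omega>. indicator S \<omega> * (\<rho> ^ 1 * H 1 (X k \<omega>)) \<partial>M)"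
    using one_sided_regression_test[of "indicator S" k] by (simp add: mult.left_commute)
next
  have "integrable M (X i)" for i
    using integrable_mult_of_squares(1)[of "\<lambda>_. 1" M "X i"] square_integrable by simp
  then show "integrable M (\<lambda>\<omega>. H 1 (X (k + 1) \<omega>))" "integrable M (\<lambda>\<omega>. \<rho> ^ 1 * H 1 (X k \<omega>))"
    by simp_all
qed simp

text \<open>Write \<open>X0, X1, X2\<close> for the variables at times \<open>k, k + 1, k + 2\<close> and \<open>Q\<close> for the polynomials. Over
an event of the past of \<open>k\<close>, the integrals of \<open>X1 Q (m + 1) (X2)\<close> and \<open>X1\<^sup>2 Q m (X2)\<close> are computed
in two ways. Conditioning on the past of \<open>k + 1\<close> replaces \<open>Q j (X2)\<close> by \<open>\<rho> ^ j Q j (X1)\<close>, by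
induction. Conditioning on all variables except \<open>X1\<close> replaces \<open>X1\<close> and \<open>X1\<^sup>2\<close> by expressions in
\<open>X0\<close> and \<open>X2\<close>. After expansion by the three-term recurrence, the comparison yields the linear system
of \<open>q_hermite_step_algebra\<close>. Only moments of order \<open>m + 2\<close> are assumed, so the case \<open>m = 0\<close> is
available before higher moments are known to exist.\<close>
lemma hermite_regression_step:
  assumes mom: "\<And>k. integrable M (\<lambda>\<omega>. \<bar>X k \<omega>\<bar> ^ (m + 2))"
    and IH: "\<And>j k. j \<le> m + 1 \<Longrightarrow> hermite_regression j k"
  shows "hermite_regression (m + 2) k"
proof (rule cond_exp_from_indicators[OF subalgebra_gen])
  fix S assume S: "S \<in> sets (past k)"
  have SM [measurable]: "S \<in> sets M" using S subalgebra_gen unfolding subalgebra_def by blast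
  \<comment> \<open>Every product met below is a power of one variable times a polynomial in another (or the same)
     one; times are counted from \<open>k\<close>.\<close>
  define E where "E d i j l = (\<integral>\<omega>. indicator S \<omega> * (X (k + i) \<omega> ^ d * H j (X (k + l) \<omega>)) \<partial>M)"
    for d :: nat and i :: int and j :: nat and l :: int
  define U where "U i j = E 0 0 j i" for i j
  have int: "integrable M (\<lambda>\<omega>. indicator S \<omega> * (X i \<omega> ^ d * H j (X l \<omega>)))"
    if "d + j \<le> m + 2" for d j i l
    using integrable_mult_indicator[OF SM integrable_power_times_hermite[OF mom that]] by simp
  have wS: "(\<lambda>\<omega>. indicator S \<omega> * f \<omega> :: real) \<in> borel_measurable (sigma_gen_by M X J)"
    if "{..k} \<subseteq> J" "f \<in> borel_measurable (sigma_gen_by M X J)" for f J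
  proof -
    have "S \<in> sets (sigma_gen_by M X J)" using S sets_sigma_gen_by_mono[OF that(1)] by blast
    then show ?thesis using that(2) by measurable
  qed

  have transport: "E d i j (l + 1) = \<rho> ^ j * E d i j l"
    if "0 \<le> i" "i \<le> l" "j \<le> m + 1" "d + j \<le> m + 2" for d i j l
  proof -
    have w: "(\<lambda>\<omega>. indicator S \<omega> * X (k + i) \<omega> ^ d) \<in> borel_measurable (past (k + l))"
      using that by (intro wS borel_measurable_power measurable_sigma_gen_by) auto
    have "(\<integral>\<omega>. (indicator S \<omega> * X (k + i) \<omega> ^ d) * H j (X (k + l + 1) \<omega>) \<partial>M)
        = (\<integral>\<omega>. (indicator S \<omega> * X (k + i) \<omega> ^ d) * (\<rho> ^ j * H j (X (k + l) \<omega>)) \<partial>M)"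
      using int[OF that(4)]
      by (intro cond_exp_test[OF subalgebra_gen IH[OF that(3)] w]) (auto simp: mult.assoc)
    then show ?thesis
      unfolding E_def by (simp add: mult.left_commute[of _ "\<rho> ^ j"] mult.assoc add.assoc)
  qed
  have transport2: "E d 0 j 2 = \<rho> ^ j * (\<rho> ^ j * E d 0 j 0)" if "j \<le> m + 1" "d + j \<le> m + 2" for d j
    using transport[of 0 0 j d] transport[of 0 1 j d] that by simp

  have expand1: "E 1 i j i = U i (j + 1) + q_number q j * U i (j - 1)" if "j \<le> m + 1" for i j
  proof -
    have "E 1 i j i = (\<integral>\<omega>. indicator S \<omega> * (X (k + 0) \<omega> ^ 0 * H (j + 1) (X (k + i) \<omega>))
        + q_number q j * (indicator S \<omega> * (X (k + 0) \<omega> ^ 0 * H (j - 1) (X (k + i) \<omega>))) \<partial>M)"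
      unfolding E_def
      by (intro Bochner_Integration.integral_cong refl)
         (simp add: x_times_q_hermite algebra_simps)
    also have "\<dots> = U i (j + 1) + q_number q j * U i (j - 1)"
      unfolding U_def E_def
      using int[of 0 "j + 1" "k + 0" "k + i"] int[of 0 "j - 1" "k + 0" "k + i"] that by simp
    finally show ?thesis .
  qed
  have expand2: "E 2 i m i = U i (m + 2) + (q_number q (m + 1) + q_number q m) * U i m
      + q_number q m * (q_number q (m - 1) * U i (m - 2))" for i
  proof -
    have "E 2 i m i = (\<integral>\<omega>. indicator S \<omega> * (X (k + 0) \<omega> ^ 0 * H (m + 2) (X (k + i) \<omega>))
        + (q_number q (m + 1) + q_number q m) * (indicator S \<omega> * (X (k + 0) \<omega> ^ 0 * H m (X (k + i) \<omega>)))
        + q_number q m * (q_number q (m - 1) * (indicator S \<omega> * (X (k + 0) \<omega> ^ 0 * H (m - 2) (X (k + i) \<omega>)))) \<partial>M)"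
      unfolding E_def
      by (intro Bochner_Integration.integral_cong refl)
         (simp only: x_squared_times_q_hermite, simp add: algebra_simps del: q_hermite.simps sum.lessThan_Suc)
    also have "\<dots> = U i (m + 2) + (q_number q (m + 1) + q_number q m) * U i m
      + q_number q m * (q_number q (m - 1) * U i (m - 2))"
      unfolding U_def E_def
      using int[of 0 "m + 2" "k + 0" "k + i"] int[of 0 m "k + 0" "k + i"] int[of 0 "m - 2" "k + 0" "k + i"]
      by (simp del: q_hermite.simps sum.lessThan_Suc)
    finally show ?thesis .
  qed

  have w: "(\<lambda>\<omega>. indicator S \<omega> * H j (X (k + 2) \<omega>)) \<in> borel_measurable (others (k + 1))" for j
    by (intro wS borel_measurable_poly measurable_sigma_gen_by) auto
  \<comment> \<open>the two-sided regressions at \<open>k + 1\<close>, tested on weights that avoid \<open>X (k + 1)\<close>\<close>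
  have lin: "E 1 1 (m + 1) 2 = a * (E 1 0 (m + 1) 2 + E 1 2 (m + 1) 2)"
  proof -
    have "E 1 1 (m + 1) 2 = (\<integral>\<omega>. (indicator S \<omega> * H (m + 1) (X (k + 2) \<omega>)) * X (k + 1) \<omega> \<partial>M)"
      unfolding E_def by (simp add: ac_simps del: q_hermite.simps)
    also have "\<dots> = (\<integral>\<omega>. (indicator S \<omega> * H (m + 1) (X (k + 2) \<omega>)) *
        (a * (X (k + 1 - 1) \<omega> + X (k + 1 + 1) \<omega>)) \<partial>M)"
      using int[of 1 "m + 1" "k + 1" "k + 2"]
      by (intro cond_exp_test[OF subalgebra_gen linear_regression w])
         (auto simp: ac_simps simp del: q_hermite.simps)
    also have "\<dots> = (\<integral>\<omega>. a * (indicator S \<omega> * (X (k + 0) \<omega> ^ 1 * H (m + 1) (X (k + 2) \<omega>))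
        + indicator S \<omega> * (X (k + 2) \<omega> ^ 1 * H (m + 1) (X (k + 2) \<omega>))) \<partial>M)"
      by (simp add: algebra_simps del: q_hermite.simps)
    also have "\<dots> = a * (E 1 0 (m + 1) 2 + E 1 2 (m + 1) 2)"
      unfolding E_def
      using int[of 1 "m + 1" "k + 0" "k + 2"] int[of 1 "m + 1" "k + 2" "k + 2"]
      by (simp del: q_hermite.simps)
    finally show ?thesis .
  qed
  have quad: "E 2 1 m 2 = A * E 2 0 m 2 + A * E 2 2 m 2
      + B * (E 1 0 (m + 1) 2 + q_number q m * E 1 0 (m - 1) 2) + C * U 2 m"
  proof -
    let ?J = "\<lambda>d i j l \<omega>. indicator S \<omega> * (X (k + i) \<omega> ^ d * H j (X (k + l) \<omega>))"
    have "E 2 1 m 2 = (\<integral>\<omega>. (indicator S \<omega> * H m (X (k + 2) \<omega>)) * (X (k + 1) \<omega>)\<^sup>2 \<partial>M)"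
      unfolding E_def by (simp add: ac_simps)
    also have "\<dots> = (\<integral>\<omega>. (indicator S \<omega> * H m (X (k + 2) \<omega>)) *
        (A * ((X (k + 1 - 1) \<omega>)\<^sup>2 + (X (k + 1 + 1) \<omega>)\<^sup>2) + B * X (k + 1 - 1) \<omega> * X (k + 1 + 1) \<omega> + C) \<partial>M)"
      using int[of 2 m "k + 1" "k + 2"]
      by (intro cond_exp_test[OF subalgebra_gen quadratic_regression w]) (auto simp: ac_simps)
    also have "\<dots> = (\<integral>\<omega>. A * ?J 2 0 m 2 \<omega> + A * ?J 2 2 m 2 \<omega>
        + B * (?J 1 0 (m + 1) 2 \<omega> + q_number q m * ?J 1 0 (m - 1) 2 \<omega>) + C * ?J 0 0 m 2 \<omega> \<partial>M)"
    proof (intro Bochner_Integration.integral_cong refl)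
      fix \<omega>
      have "X (k + 2) \<omega> * H m (X (k + 2) \<omega>) =
          H (m + 1) (X (k + 2) \<omega>) + q_number q m * H (m - 1) (X (k + 2) \<omega>)"
        by (simp add: x_times_q_hermite)
      then have "?J 1 0 (m + 1) 2 \<omega> + q_number q m * ?J 1 0 (m - 1) 2 \<omega>
          = indicator S \<omega> * (X k \<omega> * (X (k + 2) \<omega> * H m (X (k + 2) \<omega>)))"
        by (simp add: algebra_simps del: q_hermite.simps)
      then show "(indicator S \<omega> * H m (X (k + 2) \<omega>)) *
        (A * ((X (k + 1 - 1) \<omega>)\<^sup>2 + (X (k + 1 + 1) \<omega>)\<^sup>2) + B * X (k + 1 - 1) \<omega> * X (k + 1 + 1) \<omega> + C)
        = A * ?J 2 0 m 2 \<omega> + A * ?J 2 2 m 2 \<omega>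
        + B * (?J 1 0 (m + 1) 2 \<omega> + q_number q m * ?J 1 0 (m - 1) 2 \<omega>) + C * ?J 0 0 m 2 \<omega>"
        by (simp add: algebra_simps del: q_hermite.simps)
    qed
    also have "\<dots> = A * E 2 0 m 2 + A * E 2 2 m 2
      + B * (E 1 0 (m + 1) 2 + q_number q m * E 1 0 (m - 1) 2) + C * U 2 m"
    proof -
      have i: "integrable M (?J 2 0 m 2)" "integrable M (?J 2 2 m 2)" "integrable M (?J 1 0 (m + 1) 2)"
        "integrable M (?J 1 0 (m - 1) 2)" "integrable M (?J 0 0 m 2)"
        by (intro int; simp)+
      show ?thesis unfolding E_def U_def
        using i by (simp del: q_hermite.simps power_one_right power_0)
    qed
    finally show ?thesis .
  qed

  let ?s = "\<rho> ^ m" and ?g = "q_number q m" and ?g1 = "q_number q (m + 1)"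
  define c where "c = U 0 m"
  have U1: "U 1 j = \<rho> ^ j * U 0 j" and U2: "U 2 j = \<rho> ^ j * (\<rho> ^ j * U 0 j)" if "j \<le> m + 1" for j
    using transport[of 0 0 j 0] transport2[of j 0] that by (simp_all add: U_def)
  \<comment> \<open>Multiplying by \<open>\<rho>\<^sup>2\<close> avoids negative powers of \<open>\<rho>\<close> for \<open>m < 2\<close>, where \<open>v\<close> vanishes.\<close>
  define v where "v i = ?g * (q_number q (m - 1) * U i (m - 2))" for i
  have v: "\<rho>\<^sup>2 * v 1 = ?s * v 0" "\<rho>\<^sup>2 * \<rho>\<^sup>2 * v 2 = ?s\<^sup>2 * v 0"
  proof -
    consider "m = 0" | "m = 1" | n where "m = n + 2" by (metis add_2_eq_Suc' old.nat.exhaust One_nat_def)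
    then have "\<rho>\<^sup>2 * v 1 = ?s * v 0 \<and> \<rho>\<^sup>2 * \<rho>\<^sup>2 * v 2 = ?s\<^sup>2 * v 0"
    proof cases
      case 3
      then show ?thesis unfolding v_def
        using U1[of n] U2[of n] by (simp add: power_add power2_eq_square)
    qed (simp_all add: v_def)
    then show "\<rho>\<^sup>2 * v 1 = ?s * v 0" "\<rho>\<^sup>2 * \<rho>\<^sup>2 * v 2 = ?s\<^sup>2 * v 0" by auto
  qed
  define t where "t = ?g * E 1 0 (m - 1) 2"
  have t: "\<rho>\<^sup>2 * t = ?s\<^sup>2 * (?g * c + v 0)"
  proof (cases m)
    case (Suc n)
    have "E 1 0 n 0 = c + q_number q n * U 0 (n - 1)"
      using expand1[of n 0] Suc by (simp add: c_def)
    then show ?thesis unfolding t_def v_def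
      using transport2[of n 1] Suc by (simp add: algebra_simps power2_eq_square del: sum.lessThan_Suc)
  qed (simp add: t_def v_def)
  have cross: "E 1 0 (m + 1) 2 = \<rho>\<^sup>2 * ?s\<^sup>2 * (U 0 (m + 2) + ?g1 * c)"
    using transport2[of "m + 1" 1] expand1[of "m + 1" 0]
    by (simp add: c_def power2_eq_square del: sum.lessThan_Suc)
  have e1: "?s * \<rho> * (U 1 (m + 2) + ?g1 * (?s * c))
      = a * (\<rho>\<^sup>2 * ?s\<^sup>2 * (U 0 (m + 2) + ?g1 * c) + (U 2 (m + 2) + ?g1 * (?s\<^sup>2 * c)))"
    unfolding cross[symmetric]
    using lin transport[of 1 1 "m + 1" 1] expand1[of "m + 1" 1] expand1[of "m + 1" 2] U1[of m] U2[of m]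
    by (simp add: c_def power2_eq_square ac_simps del: sum.lessThan_Suc)
  have e2: "?s * (U 1 (m + 2) + (?g1 + ?g) * (?s * c) + v 1)
      = A * (?s\<^sup>2 * (U 0 (m + 2) + (?g1 + ?g) * c + v 0)) + A * (U 2 (m + 2) + (?g1 + ?g) * (?s\<^sup>2 * c) + v 2)
        + B * (\<rho>\<^sup>2 * ?s\<^sup>2 * (U 0 (m + 2) + ?g1 * c) + t) + C * (?s\<^sup>2 * c)"
  proof -
    have l: "E 2 1 m 2 = ?s * (U 1 (m + 2) + (?g1 + ?g) * (?s * c) + v 1)"
      using transport[of 1 1 m 2] expand2[of 1] U1[of m] by (simp add: c_def v_def del: sum.lessThan_Suc)
    have r0: "E 2 0 m 2 = ?s\<^sup>2 * (U 0 (m + 2) + (?g1 + ?g) * c + v 0)"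
      using transport2[of m 2] expand2[of 0] by (simp add: c_def v_def power2_eq_square del: sum.lessThan_Suc)
    have r2: "E 2 2 m 2 = U 2 (m + 2) + (?g1 + ?g) * (?s\<^sup>2 * c) + v 2"
      using expand2[of 2] U2[of m] by (simp add: c_def v_def power2_eq_square del: sum.lessThan_Suc)
    have u2: "U 2 m = ?s\<^sup>2 * c" using U2[of m] by (simp add: c_def power2_eq_square)
    show ?thesis using quad unfolding l r0 r2 u2 cross t_def by simp
  qed
  have "U 1 (m + 2) = \<rho>\<^sup>2 * ?s * U 0 (m + 2)"
    by (rule q_hermite_step_algebra[OF rho(1) _ a compat
          leading_coefficient_nonzero[OF rho compat B_nonneg] C q _ e1 e2 v t])
       (use rho q_number_Suc in auto)
  then show "(\<integral>\<omega>. indicator S \<omega> * H (m + 2) (X (k + 1) \<omega>) \<partial>M)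
      = (\<integral>\<omega>. indicator S \<omega> * (\<rho> ^ (m + 2) * H (m + 2) (X k \<omega>)) \<partial>M)"
    unfolding U_def E_def by (simp add: mult.left_commute[of "indicator _ _"] power2_eq_square mult.assoc del: q_hermite.simps)
next
  show "integrable M (\<lambda>\<omega>. H (m + 2) (X (k + 1) \<omega>))"
    "integrable M (\<lambda>\<omega>. \<rho> ^ (m + 2) * H (m + 2) (X k \<omega>))"
    using integrable_power_times_hermite[OF mom, of 0 "m + 2" k] by (simp_all del: q_hermite.simps)
  show "(\<lambda>\<omega>. \<rho> ^ (m + 2) * H (m + 2) (X k \<omega>)) \<in> borel_measurable (past k)"
    by (intro borel_measurable_times borel_measurable_poly measurable_sigma_gen_by borel_measurable_const) auto
qed

end

section \<open>Existence of all moments\<close>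

text \<open>Here \<open>x\<close> and \<open>y\<close> stand for two neighbours, and \<open>y - \<rho> x\<close>, \<open>x - \<rho> y\<close> for the two innovations.
If \<open>\<bar>y\<bar>\<close> is small compared with \<open>\<bar>x\<bar>\<close>, the first innovation alone is of the order of \<open>x\<close>. Otherwise
\<open>(1 - \<rho>\<^sup>2) x = (x - \<rho> y) + \<rho> (y - \<rho> x)\<close> bounds \<open>x\<^sup>2\<close> by the squares of both, and \<open>\<bar>x\<bar> ^ p\<close> may be
replaced by a multiple of \<open>\<bar>y\<bar> ^ p\<close>. In this way each innovation is paired with a power of the variable on
which it is conditioned.\<close>
lemma power_le_innovations:
  fixes x y \<rho> :: real
  assumes rho: "\<rho> \<noteq> 0" "\<bar>\<rho>\<bar> < 1"
  shows "\<bar>x\<bar> ^ (p + 2) \<le> (4 / \<rho>\<^sup>2 + 2 / (1 - \<rho>\<^sup>2)\<^sup>2) * ((y - \<rho> * x)\<^sup>2 * \<bar>x\<bar> ^ p)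
     + 2 / (1 - \<rho>\<^sup>2)\<^sup>2 * (2 / \<bar>\<rho>\<bar>) ^ p * ((x - \<rho> * y)\<^sup>2 * \<bar>y\<bar> ^ p)"
proof -
  define D where "D = y - \<rho> * x"
  define D' where "D' = x - \<rho> * y"
  define c where "c = 1 - \<rho>\<^sup>2"
  have c: "c > 0" using rho by (simp add: c_def abs_square_less_1)
  have r: "\<bar>\<rho>\<bar> > 0" using rho by simp
  have pow: "\<bar>x\<bar> ^ (p + 2) = x\<^sup>2 * \<bar>x\<bar> ^ p" by (simp add: power_add power2_eq_square)
  have nn: "0 \<le> D\<^sup>2 * \<bar>x\<bar> ^ p" "0 \<le> D'\<^sup>2 * \<bar>y\<bar> ^ p" "0 \<le> 4 / \<rho>\<^sup>2" "0 \<le> 2 / c\<^sup>2"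
    by auto
  show ?thesis
  proof (cases "2 * \<bar>y\<bar> < \<bar>\<rho>\<bar> * \<bar>x\<bar>")
    case True
    have "\<bar>\<rho>\<bar> * \<bar>x\<bar> \<le> \<bar>D\<bar> + \<bar>y\<bar>"
      unfolding D_def abs_mult[symmetric] by linarith
    then have "\<bar>\<rho>\<bar> * \<bar>x\<bar> \<le> 2 * \<bar>D\<bar>" using True by linarith
    then have "(\<bar>\<rho>\<bar> * \<bar>x\<bar>)\<^sup>2 \<le> (2 * \<bar>D\<bar>)\<^sup>2" by (intro power_mono) auto
    then have "x\<^sup>2 \<le> 4 / \<rho>\<^sup>2 * D\<^sup>2" using rho by (simp add: power_mult_distrib field_simps)
    then have "\<bar>x\<bar> ^ (p + 2) \<le> 4 / \<rho>\<^sup>2 * (D\<^sup>2 * \<bar>x\<bar> ^ p)"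
      unfolding pow using mult_right_mono[of "x\<^sup>2" "4 / \<rho>\<^sup>2 * D\<^sup>2" "\<bar>x\<bar> ^ p"] by (simp add: mult.assoc)
    also have "\<dots> \<le> (4 / \<rho>\<^sup>2 + 2 / c\<^sup>2) * (D\<^sup>2 * \<bar>x\<bar> ^ p)"
      using nn by (intro mult_right_mono) auto
    also have "\<dots> \<le> (4 / \<rho>\<^sup>2 + 2 / c\<^sup>2) * (D\<^sup>2 * \<bar>x\<bar> ^ p) + 2 / c\<^sup>2 * (2 / \<bar>\<rho>\<bar>) ^ p * (D'\<^sup>2 * \<bar>y\<bar> ^ p)"
      using nn by simp
    finally show ?thesis by (simp add: D_def D'_def c_def)
  next
    case False
    then have xy: "\<bar>x\<bar> \<le> 2 / \<bar>\<rho>\<bar> * \<bar>y\<bar>" using r by (simp add: field_simps)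
    have "c * x = D' + \<rho> * D" by (simp add: c_def D_def D'_def power2_eq_square algebra_simps)
    then have "c\<^sup>2 * x\<^sup>2 = (D' + \<rho> * D)\<^sup>2" by (metis power_mult_distrib)
    also have "\<dots> \<le> 2 * D'\<^sup>2 + 2 * (\<rho> * D)\<^sup>2"
      using sum_squares_bound[of D' "\<rho> * D"] by (simp add: power2_sum)
    also have "\<dots> \<le> 2 * D'\<^sup>2 + 2 * D\<^sup>2"
      using c by (simp add: power_mult_distrib mult_left_le_one_le c_def)
    finally have "x\<^sup>2 \<le> 2 / c\<^sup>2 * (D\<^sup>2 + D'\<^sup>2)" using c by (simp add: field_simps)
    then have "\<bar>x\<bar> ^ (p + 2) \<le> 2 / c\<^sup>2 * (D\<^sup>2 + D'\<^sup>2) * \<bar>x\<bar> ^ p"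
      unfolding pow by (intro mult_right_mono) auto
    also have "\<dots> = 2 / c\<^sup>2 * (D\<^sup>2 * \<bar>x\<bar> ^ p) + 2 / c\<^sup>2 * (D'\<^sup>2 * \<bar>x\<bar> ^ p)"
      by (simp add: algebra_simps add_divide_distrib)
    also have "\<dots> \<le> (4 / \<rho>\<^sup>2 + 2 / c\<^sup>2) * (D\<^sup>2 * \<bar>x\<bar> ^ p) + 2 / c\<^sup>2 * (D'\<^sup>2 * (2 / \<bar>\<rho>\<bar> * \<bar>y\<bar>) ^ p)"
      using nn xy by (intro add_mono mult_right_mono mult_left_mono power_mono) auto
    finally show ?thesis by (simp only: D_def D'_def c_def power_mult_distrib ac_simps)
  qed
qed

context quadratic_regression_field
begin

lemma reflected_quadratic_field: "quadratic_regression_field M (\<lambda>j. X (- j)) a \<rho> A B C q"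
proof -
  interpret R: linear_regression_field M "\<lambda>j. X (- j)" a \<rho> by (rule reflected_field)
  show ?thesis
  proof unfold_locales
    show "AE \<omega> in M. real_cond_exp M (sigma_gen_by M (\<lambda>j. X (- j)) {j. j \<noteq> k}) (\<lambda>\<omega>. (X (- k) \<omega>)\<^sup>2) \<omega>
         = A * ((X (- (k - 1)) \<omega>)\<^sup>2 + (X (- (k + 1)) \<omega>)\<^sup>2) + B * X (- (k - 1)) \<omega> * X (- (k + 1)) \<omega> + C" for k
    proof -
      have "uminus ` {j. j \<noteq> k} = {j. j \<noteq> - k}"
        by (auto simp: image_iff) (metis minus_minus)
      then show ?thesis
        using quadratic_regression[of "- k"] sigma_gen_by_reindex[of M X uminus]
        by (simp add: add.commute minus_diff_commute mult.commute mult.left_commute)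
    qed
  qed (use compat B_nonneg C q in auto)
qed

lemma hermite_regression_two: "hermite_regression 2 k"
proof -
  have "integrable M (\<lambda>\<omega>. \<bar>X k \<omega>\<bar> ^ (0 + 2))" for k using square_integrable by (simp add: power2_eq_square)
  moreover have "hermite_regression j k" if "j \<le> 0 + 1" for j k
    using that hermite_regression_zero hermite_regression_one by (cases j) auto
  ultimately show ?thesis using hermite_regression_step[of 0 k] by (simp only: add_0)
qed

text \<open>The conditional variance of \<open>X (k + 1)\<close> given the past is the constant \<open>1 - \<rho>\<^sup>2\<close>: the quadratic
polynomial is \<open>x\<^sup>2 - 1\<close>, so its regression says
\<open>E(X (k + 1)\<^sup>2 | past k) = \<rho>\<^sup>2 X k\<^sup>2 + 1 - \<rho>\<^sup>2\<close>.\<close>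
lemma innovation_variance:
  assumes S: "S \<in> sets (past k)"
  shows "integrable M (\<lambda>\<omega>. (X (k + 1) \<omega> - \<rho> * X k \<omega>)\<^sup>2)"
    and "(\<integral>\<omega>. indicator S \<omega> * (X (k + 1) \<omega> - \<rho> * X k \<omega>)\<^sup>2 \<partial>M) = (1 - \<rho>\<^sup>2) * measure M S"
proof -
  let ?I = "indicator S :: 'a \<Rightarrow> real"
  have SM [measurable]: "S \<in> sets M" using S subalgebra_gen unfolding subalgebra_def by blast
  have IF: "?I \<in> borel_measurable (past k)" using S by simp
  have prod: "integrable M (\<lambda>\<omega>. X i \<omega> * X j \<omega>)" for i j
    by (intro integrable_mult_of_squares square_integrable) auto
  have int: "integrable M (\<lambda>\<omega>. ?I \<omega> * (X i \<omega> * X j \<omega>))" for i j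
    using integrable_mult_indicator[OF SM prod] by simp
  have I: "integrable M ?I" using SM by (intro integrable_real_indicator) (simp_all add: emeasure_eq_measure)
  have sq: "(X (k + 1) \<omega> - \<rho> * X k \<omega>)\<^sup>2 = X (k + 1) \<omega> * X (k + 1) \<omega>
      - 2 * \<rho> * (X k \<omega> * X (k + 1) \<omega>) + \<rho>\<^sup>2 * (X k \<omega> * X k \<omega>)" for \<omega>
    by (simp add: power2_eq_square algebra_simps)
  show "integrable M (\<lambda>\<omega>. (X (k + 1) \<omega> - \<rho> * X k \<omega>)\<^sup>2)"
    unfolding sq using prod by auto
  have H2: "H 2 x = x * x - 1" for x by (simp add: numeral_2_eq_2)
  have diff: "(\<integral>\<omega>. ?I \<omega> * (X i \<omega> * X i \<omega> - 1) \<partial>M) = (\<integral>\<omega>. ?I \<omega> * (X i \<omega> * X i \<omega>) \<partial>M) - measure M S"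
    "integrable M (\<lambda>\<omega>. ?I \<omega> * (X i \<omega> * X i \<omega> - 1))" for i
    using int[of i i] I by (simp_all add: right_diff_distrib)
  have "(\<integral>\<omega>. ?I \<omega> * H 2 (X (k + 1) \<omega>) \<partial>M) = (\<integral>\<omega>. ?I \<omega> * (\<rho> ^ 2 * H 2 (X k \<omega>)) \<partial>M)"
    using diff(2) by (intro cond_exp_test[OF subalgebra_gen hermite_regression_two IF]) (auto simp: H2)
  also have "\<dots> = \<rho>\<^sup>2 * (\<integral>\<omega>. ?I \<omega> * H 2 (X k \<omega>) \<partial>M)"
    by (simp add: mult.left_commute[of "indicator _ _"])
  finally have e2: "(\<integral>\<omega>. ?I \<omega> * (X (k + 1) \<omega> * X (k + 1) \<omega>) \<partial>M) - measure M S
      = \<rho>\<^sup>2 * ((\<integral>\<omega>. ?I \<omega> * (X k \<omega> * X k \<omega>) \<partial>M) - measure M S)"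
    by (simp only: H2 diff)
  have w: "(\<lambda>\<omega>. ?I \<omega> * X k \<omega>) \<in> borel_measurable (past k)"
    by (intro borel_measurable_times IF measurable_sigma_gen_by) auto
  have "integrable M (\<lambda>\<omega>. (?I \<omega> * X k \<omega>)\<^sup>2)"
    using int[of k k] by (rule integrable_cong_AE_imp) (auto simp: indicator_def power2_eq_square)
  from one_sided_regression_test[OF w this]
  have e1: "(\<integral>\<omega>. ?I \<omega> * (X k \<omega> * X (k + 1) \<omega>) \<partial>M) = \<rho> * (\<integral>\<omega>. ?I \<omega> * (X k \<omega> * X k \<omega>) \<partial>M)"
    by (simp add: mult.assoc)
  have "(\<integral>\<omega>. ?I \<omega> * (X (k + 1) \<omega> - \<rho> * X k \<omega>)\<^sup>2 \<partial>M)
      = (\<integral>\<omega>. ?I \<omega> * (X (k + 1) \<omega> * X (k + 1) \<omega>) - 2 * \<rho> * (?I \<omega> * (X k \<omega> * X (k + 1) \<omega>))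
         + \<rho>\<^sup>2 * (?I \<omega> * (X k \<omega> * X k \<omega>)) \<partial>M)"
    unfolding sq by (simp add: algebra_simps)
  also have "\<dots> = (\<integral>\<omega>. ?I \<omega> * (X (k + 1) \<omega> * X (k + 1) \<omega>) \<partial>M)
      - 2 * \<rho> * (\<integral>\<omega>. ?I \<omega> * (X k \<omega> * X (k + 1) \<omega>) \<partial>M) + \<rho>\<^sup>2 * (\<integral>\<omega>. ?I \<omega> * (X k \<omega> * X k \<omega>) \<partial>M)"
    using int by simp
  also have "\<dots> = (1 - \<rho>\<^sup>2) * measure M S"
    using e1 e2 by (simp add: algebra_simps power2_eq_square)
  finally show "(\<integral>\<omega>. ?I \<omega> * (X (k + 1) \<omega> - \<rho> * X k \<omega>)\<^sup>2 \<partial>M) = (1 - \<rho>\<^sup>2) * measure M S" .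
qed

text \<open>As the product is not known to be integrable beforehand, the conditional variance is moved inside
with the conditional expectation of nonnegative functions, which needs no integrability.\<close>
lemma integrable_innovation_times_power:
  assumes int: "integrable M (\<lambda>\<omega>. \<bar>X k \<omega>\<bar> ^ p)"
  shows "integrable M (\<lambda>\<omega>. (X (k + 1) \<omega> - \<rho> * X k \<omega>)\<^sup>2 * \<bar>X k \<omega>\<bar> ^ p)"
proof -
  interpret P: finite_measure_subalgebra M "past k" by unfold_locales (rule subalgebra_gen)
  let ?D = "\<lambda>\<omega>. (X (k + 1) \<omega> - \<rho> * X k \<omega>)\<^sup>2"
  have c: "1 - \<rho>\<^sup>2 \<ge> 0" using rho abs_square_less_1[of \<rho>] by simp
  have ce: "AE \<omega> in M. ennreal (1 - \<rho>\<^sup>2) = nn_cond_exp M (past k) (\<lambda>\<omega>. ennreal (?D \<omega>)) \<omega>"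
  proof (rule P.nn_cond_exp_charact)
    fix S assume S: "S \<in> sets (past k)"
    have SM [measurable]: "S \<in> sets M" using S subalgebra_gen unfolding subalgebra_def by blast
    have "(\<integral>\<^sup>+\<omega>\<in>S. ennreal (?D \<omega>) \<partial>M) = (\<integral>\<^sup>+\<omega>. ennreal (indicator S \<omega> * ?D \<omega>) \<partial>M)"
      by (intro nn_integral_cong) (auto simp: indicator_def)
    also have "\<dots> = ennreal (\<integral>\<omega>. indicator S \<omega> * ?D \<omega> \<partial>M)"
      using integrable_mult_indicator[OF SM innovation_variance(1)[OF S]]
      by (intro nn_integral_eq_integral) auto
    also have "\<dots> = ennreal (1 - \<rho>\<^sup>2) * emeasure M S"
      using c by (simp add: innovation_variance(2)[OF S] ennreal_mult emeasure_eq_measure)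
    also have "\<dots> = (\<integral>\<^sup>+\<omega>\<in>S. ennreal (1 - \<rho>\<^sup>2) \<partial>M)"
      by (simp add: nn_integral_cmult_indicator)
    finally show "(\<integral>\<^sup>+\<omega>\<in>S. ennreal (?D \<omega>) \<partial>M) = (\<integral>\<^sup>+\<omega>\<in>S. ennreal (1 - \<rho>\<^sup>2) \<partial>M)" .
  qed measurable
  have w: "(\<lambda>\<omega>. ennreal (\<bar>X k \<omega>\<bar> ^ p)) \<in> borel_measurable (past k)"
    by (intro measurable_compose[OF _ measurable_ennreal] borel_measurable_power borel_measurable_abs
        measurable_sigma_gen_by) auto
  have "(\<integral>\<^sup>+\<omega>. ennreal (?D \<omega> * \<bar>X k \<omega>\<bar> ^ p) \<partial>M) = (\<integral>\<^sup>+\<omega>. ennreal (\<bar>X k \<omega>\<bar> ^ p) * ennreal (?D \<omega>) \<partial>M)"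
    by (intro nn_integral_cong) (simp add: ennreal_mult[symmetric] mult.commute)
  also have "\<dots> = (\<integral>\<^sup>+\<omega>. ennreal (\<bar>X k \<omega>\<bar> ^ p) * nn_cond_exp M (past k) (\<lambda>\<omega>. ennreal (?D \<omega>)) \<omega> \<partial>M)"
    by (rule P.nn_cond_exp_intg[symmetric, OF w]) measurable
  also have "\<dots> = (\<integral>\<^sup>+\<omega>. ennreal (\<bar>X k \<omega>\<bar> ^ p) * ennreal (1 - \<rho>\<^sup>2) \<partial>M)"
    by (rule nn_integral_cong_AE) (use ce in auto)
  also have "\<dots> = (\<integral>\<^sup>+\<omega>. ennreal (\<bar>X k \<omega>\<bar> ^ p) \<partial>M) * ennreal (1 - \<rho>\<^sup>2)"
    by (rule nn_integral_multc) measurable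
  also have "\<dots> < \<infinity>"
    using int by (simp add: nn_integral_eq_integral ennreal_mult_less_top)
  finally show ?thesis by (intro integrableI_bounded) auto
qed

text \<open>Two more moments at each step: the moment of order \<open>2 p\<close> makes both innovations, each weighted by
the \<open>2 p\<close>-th power of its own conditioning variable, integrable; the backward one is the
forward one of the reflected process.\<close>
lemma integrable_even_power: "integrable M (\<lambda>\<omega>. \<bar>X k \<omega>\<bar> ^ (2 * p))"
proof (induction p arbitrary: k)
  case (Suc p)
  interpret R: quadratic_regression_field M "\<lambda>j. X (- j)" a \<rho> A B C q
    by (rule reflected_quadratic_field)
  have fwd: "integrable M (\<lambda>\<omega>. (X (k + 1) \<omega> - \<rho> * X k \<omega>)\<^sup>2 * \<bar>X k \<omega>\<bar> ^ (2 * p))"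
    by (rule integrable_innovation_times_power[OF Suc.IH])
  have bwd: "integrable M (\<lambda>\<omega>. (X k \<omega> - \<rho> * X (k + 1) \<omega>)\<^sup>2 * \<bar>X (k + 1) \<omega>\<bar> ^ (2 * p))"
    using R.integrable_innovation_times_power[of "- (k + 1)" "2 * p"] Suc.IH[of "k + 1"]
    by (simp add: add.commute)
  show ?case
  proof (rule Bochner_Integration.integrable_bound)
    let ?K = "4 / \<rho>\<^sup>2 + 2 / (1 - \<rho>\<^sup>2)\<^sup>2" and ?L = "2 / (1 - \<rho>\<^sup>2)\<^sup>2 * (2 / \<bar>\<rho>\<bar>) ^ (2 * p)"
    let ?f = "\<lambda>\<omega>. ?K * ((X (k + 1) \<omega> - \<rho> * X k \<omega>)\<^sup>2 * \<bar>X k \<omega>\<bar> ^ (2 * p))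
      + ?L * ((X k \<omega> - \<rho> * X (k + 1) \<omega>)\<^sup>2 * \<bar>X (k + 1) \<omega>\<bar> ^ (2 * p))"
    show "integrable M ?f"
      by (intro Bochner_Integration.integrable_add integrable_mult_right fwd bwd)
    show "AE \<omega> in M. norm (\<bar>X k \<omega>\<bar> ^ (2 * Suc p)) \<le> norm (?f \<omega>)"
    proof (intro AE_I2)
      fix \<omega>
      have "\<bar>X k \<omega>\<bar> ^ (2 * Suc p) \<le> ?f \<omega>"
        using power_le_innovations[OF rho, of "X k \<omega>" "2 * p" "X (k + 1) \<omega>"] by (simp only: mult_Suc_right add.commute)
      then show "norm (\<bar>X k \<omega>\<bar> ^ (2 * Suc p)) \<le> norm (?f \<omega>)" by (simp only: real_norm_def power_abs[symmetric] abs_abs abs_power2)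
    qed
  qed measurable
qed simp

lemma integrable_power: "integrable M (\<lambda>\<omega>. \<bar>X k \<omega>\<bar> ^ N)"
proof (rule Bochner_Integration.integrable_bound)
  show "integrable M (\<lambda>\<omega>. 1 + \<bar>X k \<omega>\<bar> ^ (2 * N))" using integrable_even_power by auto
  have "t ^ N \<le> 1 + t ^ (2 * N)" if "t \<ge> 0" for t :: real
  proof -
    have "2 * t ^ N \<le> 1 + t ^ (2 * N)"
      using sum_squares_bound[of 1 "t ^ N"] by (simp add: power_mult[symmetric] mult.commute)
    moreover have "0 \<le> t ^ N" using that by simp
    ultimately show ?thesis by linarith
  qed
  then show "AE \<omega> in M. norm (\<bar>X k \<omega>\<bar> ^ N) \<le> norm (1 + \<bar>X k \<omega>\<bar> ^ (2 * N))"
    by (intro AE_I2) (auto intro: order_trans)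
qed measurable

section \<open>Regression in all degrees\<close>

lemma hermite_regression_all: "hermite_regression n k"
proof (induction n arbitrary: k rule: less_induct)
  case (less n)
  consider "n = 0" | "n = 1" | m where "n = m + 2"
    by (metis add_2_eq_Suc' old.nat.exhaust One_nat_def)
  then show ?case
  proof cases
    case 3
    then show ?thesis
      using hermite_regression_step[OF integrable_power, of m k] less.IH by simp
  qed (use hermite_regression_zero hermite_regression_one in auto)
qed

lemma integrable_hermite: "integrable M (\<lambda>\<omega>. H n (X k \<omega>))"
  using integrable_power_times_hermite[OF integrable_power, of 0 n n k k] by simp

text \<open>The regression on the whole past is already a function of \<open>X k\<close>, hence also the regression on
\<open>X k\<close> alone.\<close>
lemma hermite_regression_neighbour:
  "AE \<omega> in M. real_cond_exp M (sigma_gen_by M X {k}) (\<lambda>\<omega>. H n (X (k + 1) \<omega>)) \<omega>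
     = \<rho> ^ n * H n (X k \<omega>)"
proof (rule cond_exp_from_indicators[OF subalgebra_gen])
  fix S assume S: "S \<in> sets (sigma_gen_by M X {k})"
  then have Sp: "S \<in> sets (past k)" using sets_sigma_gen_by_mono[of "{k}" "{..k}" M X] by auto
  then have SM: "S \<in> sets M" using subalgebra_gen unfolding subalgebra_def by blast
  show "(\<integral>\<omega>. indicator S \<omega> * H n (X (k + 1) \<omega>) \<partial>M) = (\<integral>\<omega>. indicator S \<omega> * (\<rho> ^ n * H n (X k \<omega>)) \<partial>M)"
    using Sp integrable_mult_indicator[OF SM integrable_hermite]
    by (intro cond_exp_test[OF subalgebra_gen hermite_regression_all]) auto
next
  show "(\<lambda>\<omega>. \<rho> ^ n * H n (X k \<omega>)) \<in> borel_measurable (sigma_gen_by M X {k})"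
    by (intro borel_measurable_times borel_measurable_poly measurable_sigma_gen_by borel_measurable_const) auto
qed (use integrable_hermite in auto)

end

section \<open>The conditional expectations of q-Hermite polynomials\<close>

theorem lemma6p3:
  fixes M :: "'a measure"
    and X :: "int \<Rightarrow> 'a \<Rightarrow> real"
    and \<rho> r2 a b A B C R q :: real
    and Q :: "int \<Rightarrow> real poly"
  assumes "prob_space M"
    and "L2_stationary M X"
    and "\<And>k. integral\<^sup>L M (X k) = 0"
    and "\<And>k. (\<integral>\<omega>. (X k \<omega>)\<^sup>2 \<partial>M) = 1"
    and "\<And>k. distr M borel (X k) = distr M borel (X 0)"
    and "\<rho> = corr M (X 0) (X 1)"
    and "r2 = corr M (X 0) (X 2)"
    and "\<rho> \<noteq> 0"
    and "r2 + 1 - 2 * \<bar>\<rho>\<bar> > 0"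
    and "\<And>k. AE \<omega> in M. real_cond_exp M (sigma_gen_by M X {j. j \<noteq> k}) (X k) \<omega>
            = a * (X (k - 1) \<omega> + X (k + 1) \<omega>) + b"
    and "\<And>k. AE \<omega> in M. real_cond_exp M (sigma_gen_by M X {j. j \<noteq> k}) (\<lambda>\<omega>. (X k \<omega>)\<^sup>2) \<omega>
            = A * ((X (k - 1) \<omega>)\<^sup>2 + (X (k + 1) \<omega>)\<^sup>2) + B * X (k - 1) \<omega> * X (k + 1) \<omega> + C"
    and "A * (\<rho>\<^sup>2 + 1 / \<rho>\<^sup>2) + B = 1"
    and "R = B * (\<rho> + 1 / \<rho>)\<^sup>2"
    and "R \<ge> 0"
    and "q = (\<rho> ^ 4 + R - 1) / (1 + \<rho> ^ 4 * (R - 1))"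
    and "Q (- 1) = 0"
    and "Q 0 = 1"
    and "\<And>n::nat. [:0, 1:] * Q (int n)
            = Q (int n + 1) + smult (\<Sum>i<n. q ^ i) (Q (int n - 1))"
  shows "\<forall>n::nat. integrable M (\<lambda>\<omega>. poly (Q (int n)) (X 1 \<omega>)) \<and>
           (AE \<omega> in M. real_cond_exp M (sigma_gen_by M X {0}) (\<lambda>\<omega>. poly (Q (int n)) (X 1 \<omega>)) \<omega>
              = \<rho> ^ n * poly (Q (int n)) (X 0 \<omega>))"
proof -
  interpret prob_space M by (rule assms(1))
  have rv [measurable]: "\<And>k. X k \<in> borel_measurable M"
    and sq: "\<And>k. integrable M (\<lambda>\<omega>. (X k \<omega>)\<^sup>2)"
    and stat: "\<And>j k l. (\<integral>\<omega>. X k \<omega> * X (k + j) \<omega> \<partial>M) = (\<integral>\<omega>. X l \<omega> * X (l + j) \<omega> \<partial>M)"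
    using assms(2) unfolding L2_stationary_def by auto
  have mean: "\<And>k. integral\<^sup>L M (X k) = 0" and var: "\<And>k. (\<integral>\<omega>. (X k \<omega>)\<^sup>2 \<partial>M) = 1"
    using assms(3,4) by auto
  have intX: "integrable M (X k)" for k
    by (rule square_integrable_imp_integrable[OF rv sq])
  have prod: "integrable M (\<lambda>\<omega>. X i \<omega> * X j \<omega>)" for i j
    by (intro integrable_mult_of_squares rv sq)
  have corr_eq: "corr M (X i) (X j) = (\<integral>\<omega>. X i \<omega> * X j \<omega> \<partial>M)" for i j
    by (simp add: corr_def covar_def mean var power2_eq_square[symmetric])
  have sub: "subalgebra M (sigma_gen_by M X J)" for J
    by (rule subalgebra_sigma_gen_by) (rule rv)

  have b: "b = 0"
  proof -
    have "(\<integral>\<omega>. 1 * X 0 \<omega> \<partial>M) = (\<integral>\<omega>. 1 * (a * (X (0 - 1) \<omega> + X (0 + 1) \<omega>) + b) \<partial>M)"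
      using intX by (intro cond_exp_test[OF sub assms(10)]) auto
    then show ?thesis using intX by (simp add: mean prob_space)
  qed
  \<comment> \<open>The covariances with the neighbours give \<open>a = \<rho> / (1 + r2)\<close>, and \<open>r2 + 1 > 2 \<bar>\<rho>\<bar>\<close> becomes the
     condition under which \<open>a (1 + x\<^sup>2) = x\<close> has a root inside the unit interval.\<close>
  have a_r2: "\<rho> = a * (1 + r2)"
  proof -
    have "(\<integral>\<omega>. X 0 \<omega> * X 1 \<omega> \<partial>M) = (\<integral>\<omega>. X 0 \<omega> * (a * (X (1 - 1) \<omega> + X (1 + 1) \<omega>) + b) \<partial>M)"
      using prod by (intro cond_exp_test[OF sub assms(10)] measurable_sigma_gen_by) auto
    also have "\<dots> = (\<integral>\<omega>. a * ((X 0 \<omega>)\<^sup>2 + X 0 \<omega> * X 2 \<omega>) \<partial>M)"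
      by (simp add: b algebra_simps power2_eq_square)
    also have "\<dots> = a * (1 + r2)"
      using prod sq by (simp add: var assms(7) corr_eq)
    finally show ?thesis by (simp add: assms(6) corr_eq)
  qed
  have a0: "a \<noteq> 0" using a_r2 assms(8) by auto
  have pos: "1 + r2 > 0" using assms(9) abs_ge_zero[of \<rho>] by linarith
  then have "\<bar>\<rho>\<bar> = \<bar>a\<bar> * (1 + r2)" using a_r2 by (simp add: abs_mult)
  then have "(1 + r2) * (2 * \<bar>a\<bar>) < (1 + r2) * 1" using assms(9) by (simp add: mult.commute mult.left_commute add.commute)
  then have "2 * \<bar>a\<bar> < 1" using pos by (simp only: mult_less_cancel_left_pos)
  then have a_half: "\<bar>a\<bar> < 1 / 2" by simp
  obtain \<theta> where theta: "\<theta> \<noteq> 0" "\<bar>\<theta>\<bar> < 1" "a * (1 + \<theta>\<^sup>2) = \<theta>"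
    by (rule contracting_root_exists[OF a0 a_half])
  interpret L: linear_regression_field M X a \<theta>
    by unfold_locales (use sq var theta assms(10) b in auto)
  have X0: "X 0 \<in> borel_measurable (L.past 0)" by (intro measurable_sigma_gen_by) auto
  \<comment> \<open>Testing the one-sided regression on \<open>X 0\<close> identifies this root with the correlation.\<close>
  have rho_theta: "\<rho> = \<theta>"
    using L.one_sided_regression_test[OF X0 sq]
    by (simp add: assms(6) corr_eq var power2_eq_square[symmetric])
  have X0': "X 0 \<in> borel_measurable (L.past 1)" by (intro measurable_sigma_gen_by) auto
  have r2: "r2 = \<rho>\<^sup>2"
    using L.one_sided_regression_test[OF X0' sq] corr_eq[of 0 1] corr_eq[of 0 2] rho_theta
    by (simp add: assms(6,7) power2_eq_square)
  have neighbours_of_0: "(\<integral>\<omega>. X (- 1) \<omega> * X 1 \<omega> \<partial>M) = \<rho>\<^sup>2"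
    using stat[of "- 1" 2 0] by (simp add: r2[symmetric] assms(7) corr_eq)
  have C: "C = 1 - 2 * A - B * \<rho>\<^sup>2"
  proof -
    have "(\<integral>\<omega>. 1 * (X 0 \<omega>)\<^sup>2 \<partial>M) = (\<integral>\<omega>. 1 * (A * ((X (0 - 1) \<omega>)\<^sup>2 + (X (0 + 1) \<omega>)\<^sup>2)
        + B * X (0 - 1) \<omega> * X (0 + 1) \<omega> + C) \<partial>M)"
      using sq by (intro cond_exp_test[OF sub assms(11)]) auto
    then have "1 = A * (1 + 1) + B * \<rho>\<^sup>2 + C"
      using sq prod by (simp add: var neighbours_of_0 mult.assoc prob_space)
    then show ?thesis by simp
  qed
  have rho0: "\<rho> \<noteq> 0" and rho1: "\<bar>\<rho>\<bar> < 1" using theta rho_theta by auto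
  have B: "B \<ge> 0"
  proof -
    have "\<rho> + 1 / \<rho> \<noteq> 0"
    proof
      assume "\<rho> + 1 / \<rho> = 0"
      then have "\<rho>\<^sup>2 + 1 = 0" using rho0 by (simp add: field_simps power2_eq_square)
      then show False using zero_le_power2[of \<rho>] by linarith
    qed
    then have "(\<rho> + 1 / \<rho>)\<^sup>2 > 0" by simp
    then show ?thesis using assms(13,14) by (simp add: zero_le_mult_iff)
  qed
  have q: "q * (1 - 2 * A - B * \<rho>\<^sup>2) = 2 * A + B / \<rho>\<^sup>2 - 1"
    by (rule q_from_parameters[OF rho0 rho1 assms(12-15)])
  interpret F: quadratic_regression_field M X a \<rho> A B C q
    by unfold_locales (use sq var theta rho_theta assms(10-12) b B C q in auto)

  have Q: "Q (int n) = q_hermite q n" for n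
  proof (induction n rule: induct_nat_012)
    case 1
    show ?case using assms(18)[of 0] by (simp add: assms(16,17))
  next
    case (ge2 n)
    have "Q (int (Suc (Suc n))) = [:0, 1:] * Q (int (Suc n)) - smult (q_number q (Suc n)) (Q (int n))"
      using assms(18)[of "Suc n"] by (simp add: algebra_simps del: sum.lessThan_Suc mult_pCons_left)
    then show ?case by (simp only: ge2 q_hermite.simps)
  qed (simp add: assms(17))
  show ?thesis
    using F.integrable_hermite[of _ 1] F.hermite_regression_neighbour[of 0] by (simp add: Q)
qed

end
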